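(* Let $X=\mathbb{Z}^{\mathbb{N}}$ and let $G=\mathrm{Hom}(X,\mathbb{Z})$ be the group of all group homomorphisms from $X$ to $\mathbb{Z}$, viewed as a subgroup of the Tychonoff product $\mathbb{Z}^{X}$ and endowed with the subspace topology. Then $G$ is a closed subgroup of $\mathbb{Z}^{X}$, $G$ is algebraically a free abelian group with countably many generators (i.e. free abelian of countably infinite rank), and $G$ is non-reflexive.
   Context: $\mathbb{Z}$ is the group of integers with the discrete topology. $X=\mathbb{Z}^{\mathbb{N}}$ is the Baer-Specker group, i.e. the group of all functions $\mathbb{N}\to\mathbb{Z}$ under pointwise addition. $\mathrm{Hom}(X,\mathbb{Z})$ consists of all (abstract, not assumed continuous) group homomorphisms $X\to\mathbb{Z}$, with pointwise addition. $\mathbb{Z}^{X}$ is the product of copies of the discrete group $\mathbb{Z}$ indexed by the elements of the set $X$, with the Tychonoff product topology. $\mathbb{T}=\mathbb{R}/\mathbb{Z}$ is the circle group. For an abelian topological group $H$, the (Pontryagin) dual group $\widehat{H}$ is the group of all continuous homomorphisms $H\to\mathbb{T}$ with pointwise addition, equipped with the compact-open topology. An abelian topological group $H$ is called reflexive if its second Pontryagin dual $\widehat{\widehat{H}}$ is topologically isomorphic to $H$; it is non-reflexive otherwise. *)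

theory Defs
  imports "HOL-Analysis.Analysis" "HOL-Algebra.Product_Groups" "HOL-Algebra.Free_Abelian_Groups"
begin

section \<open>Abelian topological groups\<close>

definition abelian_topological_group :: "('a, 'm) monoid_scheme \<Rightarrow> 'a topology \<Rightarrow> bool" where
  "abelian_topological_group G T \<longleftrightarrow>
     comm_group G \<and> topspace T = carrier G \<and>
     continuous_map (prod_topology T T) T (\<lambda>(x, y). x \<otimes>\<^bsub>G\<^esub> y) \<and>
     continuous_map T T (\<lambda>x. inv\<^bsub>G\<^esub> x)"

definition topologically_isomorphic ::
  "('a, 'm) monoid_scheme \<Rightarrow> 'a topology \<Rightarrow> ('b, 'n) monoid_scheme \<Rightarrow> 'b topology \<Rightarrow> bool" where
  "topologically_isomorphic G S H T \<longleftrightarrow> (\<exists>f \<in> iso G H. homeomorphic_map S T f)"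


section \<open>The circle group\<close>

definition quotient_topology :: "'a topology \<Rightarrow> ('a \<Rightarrow> 'b) \<Rightarrow> 'b topology" where
  "quotient_topology T q =
     topology (\<lambda>U. U \<subseteq> q ` topspace T \<and> openin T {x \<in> topspace T. q x \<in> U})"

lemma openin_quotient_topology:
  "openin (quotient_topology T q) U \<longleftrightarrow>
     U \<subseteq> q ` topspace T \<and> openin T {x \<in> topspace T. q x \<in> U}"
proof -
  have "istopology (\<lambda>U. U \<subseteq> q ` topspace T \<and> openin T {x \<in> topspace T. q x \<in> U})"
    unfolding istopology_def
  proof (rule conjI; intro allI impI)
    fix U V
    assume U: "U \<subseteq> q ` topspace T \<and> openin T {x \<in> topspace T. q x \<in> U}"
      and V: "V \<subseteq> q ` topspace T \<and> openin T {x \<in> topspace T. q x \<in> V}"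
    have "{x \<in> topspace T. q x \<in> U \<inter> V} =
        {x \<in> topspace T. q x \<in> U} \<inter> {x \<in> topspace T. q x \<in> V}"
      by blast
    with U V show "U \<inter> V \<subseteq> q ` topspace T \<and> openin T {x \<in> topspace T. q x \<in> U \<inter> V}"
      by auto
  next
    fix \<U>
    assume \<U>: "\<forall>U\<in>\<U>. U \<subseteq> q ` topspace T \<and> openin T {x \<in> topspace T. q x \<in> U}"
    have "{x \<in> topspace T. q x \<in> \<Union>\<U>} = (\<Union>U\<in>\<U>. {x \<in> topspace T. q x \<in> U})"
      by blast
    with \<U> show "\<Union>\<U> \<subseteq> q ` topspace T \<and> openin T {x \<in> topspace T. q x \<in> \<Union>\<U>}"
      by auto
  qed
  then show ?thesis
    by (simp add: quotient_topology_def)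
qed

definition real_group :: "real monoid" where
  "real_group = \<lparr>carrier = UNIV, monoid.mult = (+), one = 0\<rparr>"

definition circle_group :: "real set monoid" where
  "circle_group = real_group Mod \<int>"

definition circle_topology :: "real set topology" where
  "circle_topology = quotient_topology euclideanreal (\<lambda>x. \<int> #>\<^bsub>real_group\<^esub> x)"


section \<open>Pontryagin duality\<close>

text \<open>Characters are functions on the carrier only, so they are normalised to be
  \<^const>\<open>undefined\<close> outside it.\<close>

definition dual_group :: "('a, 'm) monoid_scheme \<Rightarrow> 'a topology \<Rightarrow> ('a \<Rightarrow> real set) monoid" where
  "dual_group G T =
     \<lparr>carrier = {f \<in> hom G circle_group. continuous_map T circle_topology f \<and>
                               f \<in> extensional (carrier G)},
      monoid.mult = (\<lambda>f g. \<lambda>x\<in>carrier G. f x \<otimes>\<^bsub>circle_group\<^esub> g x),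
      one = (\<lambda>x\<in>carrier G. \<one>\<^bsub>circle_group\<^esub>)\<rparr>"

text \<open>The compact-open topology; its topspace is all of the dual group, as the subbasic set
  for \<^term>\<open>K = {}\<close> shows.\<close>

definition dual_topology ::
  "('a, 'm) monoid_scheme \<Rightarrow> 'a topology \<Rightarrow> ('a \<Rightarrow> real set) topology" where
  "dual_topology G T = topology_generated_by
     {{f \<in> carrier (dual_group G T). f ` K \<subseteq> U} | K U. compactin T K \<and> openin circle_topology U}"

text \<open>Reflexivity asks for some topological isomorphism with the second dual, not
  necessarily the canonical evaluation map. Non-reflexivity is a property of abelian
  topological groups, hence not just the negation of reflexivity.\<close>

definition reflexive :: "('a, 'm) monoid_scheme \<Rightarrow> 'a topology \<Rightarrow> bool" where
  "reflexive G T \<longleftrightarrow>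
     abelian_topological_group G T \<and>
     topologically_isomorphic
       (dual_group (dual_group G T) (dual_topology G T))
       (dual_topology (dual_group G T) (dual_topology G T)) G T"

definition non_reflexive :: "('a, 'm) monoid_scheme \<Rightarrow> 'a topology \<Rightarrow> bool" where
  "non_reflexive G T \<longleftrightarrow> abelian_topological_group G T \<and> \<not> reflexive G T"


section \<open>Integer-valued homomorphisms on the Baer-Specker group\<close>

definition baer_specker :: "(nat \<Rightarrow> int) monoid" where
  "baer_specker = product_group UNIV (\<lambda>_. integer_group)"

definition power_group :: "((nat \<Rightarrow> int) \<Rightarrow> int) monoid" where
  "power_group = product_group (carrier baer_specker) (\<lambda>_. integer_group)"

definition power_topology :: "((nat \<Rightarrow> int) \<Rightarrow> int) topology" where
  "power_topology = product_topology (\<lambda>_. discrete_topology UNIV) (carrier baer_specker)"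

text \<open>The carrier of \<^const>\<open>baer_specker\<close> is the whole type, so homomorphisms need no
  normalisation to be elements of \<^const>\<open>power_group\<close>.\<close>

definition hom_group :: "((nat \<Rightarrow> int) \<Rightarrow> int) monoid" where
  "hom_group = power_group\<lparr>carrier := hom baer_specker integer_group\<rparr>"

definition hom_topology :: "((nat \<Rightarrow> int) \<Rightarrow> int) topology" where
  "hom_topology = subtopology power_topology (hom baer_specker integer_group)"

end

theory Submission
  imports Defs
begin

text \<open>By Specker's theorem a homomorphism on \<open>\<int>\<^sup>\<nat>\<close> is a finite integral combination of the
  coordinates, so \<open>G\<close> is free of countable rank. A diagonal argument with a fast growing sequence
  shows that every compact subset of \<open>G\<close> involves only finitely many coordinates. Hence in the
  dual of \<open>G\<close> the circles of multiples of the coordinate functionals converge to the trivial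
  character, and their union is compact. A character of the dual that maps this union into a small
  arc is trivial on every circle, as the circle group has no small subgroups, hence trivial by
  density. So the second dual has an isolated point, whereas \<open>G\<close> has none: finitely
  many integral linear equations in infinitely many unknowns have a nonzero solution.\<close>

section \<open>Homomorphisms on the Baer-Specker group\<close>

abbreviation unit_seq :: "nat \<Rightarrow> nat \<Rightarrow> int" where
  "unit_seq n \<equiv> \<lambda>i. of_bool (i = n)"

lemma carrier_baer_specker [simp]: "carrier baer_specker = UNIV"
  by (simp add: baer_specker_def)

lemma mult_baer_specker [simp]: "x \<otimes>\<^bsub>baer_specker\<^esub> y = (\<lambda>i. x i + y i)"
  by (simp add: baer_specker_def restrict_def)

lemma carrier_power_group [simp]: "carrier power_group = UNIV"
  by (simp add: power_group_def)

lemma mult_power_group [simp]: "f \<otimes>\<^bsub>power_group\<^esub> g = (\<lambda>x. f x + g x)"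
  by (simp add: power_group_def restrict_def)

lemma one_power_group [simp]: "\<one>\<^bsub>power_group\<^esub> = (\<lambda>x. 0)"
  by (simp add: power_group_def restrict_def)

lemma group_power_group: "group power_group"
  by (simp add: power_group_def)

lemma inv_power_group [simp]: "inv\<^bsub>power_group\<^esub> f = (\<lambda>x. - f x)"
  by (rule group.inv_equality[OF group_power_group]) auto

lemma carrier_hom_group: "carrier hom_group = hom baer_specker integer_group"
  by (simp add: hom_group_def)

lemma mem_hom_group_iff:
  "f \<in> carrier hom_group \<longleftrightarrow> (\<forall>x y. f (\<lambda>i. x i + y i) = f x + f y)"
  by (simp add: carrier_hom_group hom_def)

lemma mult_hom_group [simp]: "f \<otimes>\<^bsub>hom_group\<^esub> g = (\<lambda>x. f x + g x)"
  using mult_power_group[of f g] by (simp add: hom_group_def)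

lemma one_hom_group [simp]: "\<one>\<^bsub>hom_group\<^esub> = (\<lambda>x. 0)"
  using one_power_group by (simp add: hom_group_def)

lemma hom_groupD:
  "f \<in> carrier hom_group \<Longrightarrow> f (\<lambda>i. x i + y i) = f x + f y"
  by (simp add: mem_hom_group_iff)

lemma hom_group_zero: "f \<in> carrier hom_group \<Longrightarrow> f (\<lambda>i. 0) = 0"
  using hom_groupD[of f "\<lambda>i. 0" "\<lambda>i. 0"] by simp

lemma hom_group_scale:
  assumes f: "f \<in> carrier hom_group"
  shows "f (\<lambda>i. k * x i) = k * f x"
proof (induction k rule: int_induct[where k = 0])
  case base
  show ?case using hom_group_zero[OF f] by simp
next
  case (step1 k)
  have "f (\<lambda>i. (k + 1) * x i) = f (\<lambda>i. k * x i + x i)" by (simp add: algebra_simps)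
  then show ?case using step1 hom_groupD[OF f, of "\<lambda>i. k * x i" x] by (simp add: algebra_simps)
next
  case (step2 k)
  have "f (\<lambda>i. k * x i) = f (\<lambda>i. (k - 1) * x i + x i)" by (simp add: algebra_simps)
  then show ?case using step2 hom_groupD[OF f, of "\<lambda>i. (k - 1) * x i" x] by (simp add: algebra_simps)
qed

text \<open>Additivity of \<open>f\<close> is only finite, so coordinates are peeled off one at a
  time and the infinite tail stays inside \<open>f\<close>.\<close>

lemma hom_group_split:
  assumes f: "f \<in> carrier hom_group"
  shows "f x = (\<Sum>i<n. x i * f (unit_seq i)) + f (\<lambda>i. if i < n then 0 else x i)"
proof (induction n)
  case 0
  show ?case by simp
next
  case (Suc n)
  have "(\<lambda>i. if i < n then 0 else x i)
      = (\<lambda>i. x n * unit_seq n i + (if i < Suc n then 0 else x i))"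
    by (auto simp: fun_eq_iff less_Suc_eq)
  then have "f (\<lambda>i. if i < n then 0 else x i)
      = x n * f (unit_seq n) + f (\<lambda>i. if i < Suc n then 0 else x i)"
    using hom_groupD[OF f, of "\<lambda>i. x n * unit_seq n i" "\<lambda>i. if i < Suc n then 0 else x i"]
      hom_group_scale[OF f, of "x n" "unit_seq n"] by simp
  with Suc show ?case by simp
qed

lemma hom_group_lincomb: "(\<lambda>x. \<Sum>i\<in>A. c i * x i) \<in> carrier hom_group"
  by (simp add: mem_hom_group_iff distrib_left sum.distrib)

lemma hom_group_combination:
  assumes "f \<in> carrier hom_group" "g \<in> carrier hom_group"
  shows "(\<lambda>x. a * f x + b * g x) \<in> carrier hom_group"
  using assms by (simp add: mem_hom_group_iff algebra_simps)

section \<open>Specker's theorem by fast growing sequences\<close>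

text \<open>The product makes each term a multiple of all earlier ones; the second factor lets term
  \<open>n\<close> exceed every combination of the earlier terms with coefficients bounded by row
  \<open>n\<close> of \<open>a\<close>, with \<open>int n + 1\<close> to spare. The rows may vary
  with \<open>n\<close> because the compactness argument uses a different functional for each
  \<open>n\<close>.\<close>

function growing_seq :: "(nat \<Rightarrow> nat \<Rightarrow> int) \<Rightarrow> nat \<Rightarrow> int" where
  "growing_seq a n =
     (\<Prod>i<n. growing_seq a i) * (int n + 1 + (\<Sum>i<n. \<bar>a n i\<bar> * growing_seq a i))"
  by auto
termination by (relation "Wellfounded.measure snd") auto

declare growing_seq.simps [simp del]

lemma growing_seq_pos: "growing_seq a n \<ge> 1"
proof (induction n rule: less_induct)
  case (less n)
  have "(\<Prod>i<n. growing_seq a i) \<ge> 1"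
    using less by (intro prod_ge_1) auto
  moreover have "(\<Sum>i<n. \<bar>a n i\<bar> * growing_seq a i) \<ge> 0"
    using less by (intro sum_nonneg mult_nonneg_nonneg) (auto intro: order_trans[OF zero_le_one])
  ultimately have "1 * 1 \<le> (\<Prod>i<n. growing_seq a i) * (int n + 1 + (\<Sum>i<n. \<bar>a n i\<bar> * growing_seq a i))"
    by (intro mult_mono) auto
  then show ?case by (subst growing_seq.simps) simp
qed

lemma growing_seq_ge: "growing_seq a n \<ge> int n + 1 + (\<Sum>i<n. \<bar>a n i\<bar> * growing_seq a i)"
proof -
  have "(\<Prod>i<n. growing_seq a i) \<ge> 1"
    using growing_seq_pos by (intro prod_ge_1) auto
  moreover have "(\<Sum>i<n. \<bar>a n i\<bar> * growing_seq a i) \<ge> 0"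
    using growing_seq_pos
    by (intro sum_nonneg mult_nonneg_nonneg) (auto intro: order_trans[OF zero_le_one])
  ultimately have "1 * (int n + 1 + (\<Sum>i<n. \<bar>a n i\<bar> * growing_seq a i)) \<le> growing_seq a n"
    by (subst (2) growing_seq.simps) (intro mult_right_mono, auto)
  then show ?thesis by simp
qed

lemma growing_seq_dvd: "i \<le> n \<Longrightarrow> growing_seq a i dvd growing_seq a n"
proof (cases "i = n")
  case False
  moreover assume "i \<le> n"
  ultimately have "growing_seq a i dvd (\<Prod>i<n. growing_seq a i)"
    by (intro dvd_prodI) auto
  then show ?thesis by (subst (2) growing_seq.simps) (rule dvd_mult2)
qed simp

text \<open>A common divisor can be pulled out of infinitely many coordinates at once, since
  \<open>f\<close> commutes with integer scaling. This is the only control available over an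
  infinite tail.\<close>

lemma hom_group_tail_dvd:
  assumes f: "f \<in> carrier hom_group" and d: "\<And>i. i \<ge> n \<Longrightarrow> d dvd x i"
  shows "d dvd f (\<lambda>i. if i < n then 0 else x i)"
proof -
  have "(\<lambda>i. if i < n then 0 else x i) = (\<lambda>i. d * (if i < n then 0 else x i div d))"
    using d by (auto simp: fun_eq_iff)
  from arg_cong[OF this, of f] show ?thesis
    unfolding hom_group_scale[OF f] by (rule dvdI)
qed

text \<open>For \<open>x\<close> growing fast along divisibility, the partial sum \<open>s n\<close> is congruent to \<open>f x\<close> modulo
  \<open>x n\<close> but small compared with \<open>x n\<close>; hence it equals \<open>f x\<close> for large \<open>n\<close>.\<close>

lemma hom_group_finite_support:
  assumes f: "f \<in> carrier hom_group"
  obtains n where "\<And>i. i \<ge> n \<Longrightarrow> f (unit_seq i) = 0"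
proof -
  define x where "x = growing_seq (\<lambda>n i. f (unit_seq i))"
  define s where "s n = (\<Sum>i<n. x i * f (unit_seq i))" for n
  have pos: "x n \<ge> 1" for n
    by (simp add: x_def growing_seq_pos)
  have s_eq: "s n = f x" if n: "n \<ge> nat \<bar>f x\<bar>" for n
  proof -
    have "x n dvd f x - s n"
      using hom_group_split[OF f, of x n] hom_group_tail_dvd[OF f, of n "x n" x]
      by (simp add: s_def x_def growing_seq_dvd)
    moreover have "\<bar>s n\<bar> \<le> (\<Sum>i<n. \<bar>f (unit_seq i)\<bar> * x i)"
      unfolding s_def using pos
      by (intro order_trans[OF sum_abs] sum_mono)
        (simp add: abs_mult mult.commute order_trans[OF zero_le_one])
    \<comment> \<open>The summand \<open>int n + 1\<close> in the growth bound absorbs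
      \<open>\<bar>f x\<bar>\<close>, whence the threshold on \<open>n\<close>.\<close>
    then have "\<bar>f x - s n\<bar> < x n"
      using growing_seq_ge[of n "\<lambda>n i. f (unit_seq i)", folded x_def] n by linarith
    ultimately show ?thesis
      using dvd_imp_le_int[of "f x - s n" "x n"] by force
  qed
  have "f (unit_seq i) = 0" if "i \<ge> nat \<bar>f x\<bar>" for i
  proof -
    \<comment> \<open>Two consecutive partial sums both equal \<open>f x\<close>, so the term
      between them vanishes.\<close>
    have "s (Suc i) = s i + x i * f (unit_seq i)" by (simp add: s_def)
    with s_eq[of i] s_eq[of "Suc i"] that have "x i * f (unit_seq i) = 0" by simp
    with pos[of i] show ?thesis by simp
  qed
  then show ?thesis using that by blast
qed

text \<open>The first \<open>n\<close> coordinates contribute nothing, so \<open>f x\<close> is the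
  value at a tail divisible by \<open>k ^ n\<close>, for every \<open>n\<close>. Only 0 is divisible
  by all powers of \<open>k\<close>.\<close>

lemma hom_group_eq_0_if_powers_dvd:
  assumes f: "f \<in> carrier hom_group" and units: "\<And>i. f (unit_seq i) = 0"
    and k: "k \<ge> 2" and x: "\<And>i. k ^ i dvd x i"
  shows "f x = 0"
proof (rule ccontr)
  assume "f x \<noteq> 0"
  \<comment> \<open>This exponent is large enough:
    \<open>\<bar>f x\<bar> = n < 2 ^ n \<le> k ^ n\<close>.\<close>
  define n where "n = nat \<bar>f x\<bar>"
  have "k ^ n dvd x i" if "i \<ge> n" for i
    using x[of i] le_imp_power_dvd[OF that, of k] by (rule dvd_trans[rotated])
  then have "k ^ n dvd f x"
    using hom_group_split[OF f, of x n] hom_group_tail_dvd[OF f, of n "k ^ n" x] units by simp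
  with \<open>f x \<noteq> 0\<close> have "k ^ n \<le> \<bar>f x\<bar>"
    using dvd_imp_le_int[of "f x" "k ^ n"] k by simp
  moreover have "int n < 2 ^ n" by (metis of_nat_less_two_power)
  moreover have "(2::int) ^ n \<le> k ^ n" using k by (intro power_mono) auto
  ultimately show False by (simp add: n_def)
qed

text \<open>By Bezout every sequence is a sum of one divisible termwise by \<open>2 ^ i\<close> and one by \<open>3 ^ i\<close>.\<close>

lemma hom_group_eq_0_if_units:
  assumes f: "f \<in> carrier hom_group" and units: "\<And>i. f (unit_seq i) = 0"
  shows "f x = 0"
proof -
  have "\<exists>u v. u * 2 ^ i + v * 3 ^ i = (1::int)" for i
    using bezout_int[of "2 ^ i" "3 ^ i"] by simp
  then obtain u v where uv: "u i * 2 ^ i + v i * 3 ^ i = (1::int)" for i :: nat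
    by metis
  have "x = (\<lambda>i. x i * u i * 2 ^ i + x i * v i * 3 ^ i)"
  proof
    fix i
    have "x i * (u i * 2 ^ i + v i * 3 ^ i) = x i" by (simp add: uv)
    then show "x i = x i * u i * 2 ^ i + x i * v i * 3 ^ i" by (simp add: algebra_simps)
  qed
  then have "f x = f (\<lambda>i. x i * u i * 2 ^ i) + f (\<lambda>i. x i * v i * 3 ^ i)"
    using hom_groupD[OF f] by metis
  moreover have "f (\<lambda>i. x i * u i * 2 ^ i) = 0"
    by (rule hom_group_eq_0_if_powers_dvd[OF f units, of 2]) auto
  moreover have "f (\<lambda>i. x i * v i * 3 ^ i) = 0"
    by (rule hom_group_eq_0_if_powers_dvd[OF f units, of 3]) auto
  ultimately show ?thesis by simp
qed

lemma hom_group_expansion: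
  assumes f: "f \<in> carrier hom_group" and n: "\<And>i. i \<ge> n \<Longrightarrow> f (unit_seq i) = 0"
  shows "f x = (\<Sum>i<n. f (unit_seq i) * x i)"
proof -
  \<comment> \<open>The difference vanishes on all unit sequences; the coefficients \<open>1\<close>
    and \<open>- 1\<close> give it the shape of \<open>hom_group_combination\<close>.\<close>
  let ?g = "\<lambda>x. 1 * f x + (- 1) * (\<Sum>i<n. f (unit_seq i) * x i)"
  have "?g \<in> carrier hom_group"
    by (intro hom_group_combination f hom_group_lincomb)
  moreover have "?g (unit_seq j) = 0" for j
    using n[of j] by (cases "j < n") (auto simp: of_bool_def if_distrib cong: if_cong)
  ultimately have "?g x = 0"
    by (rule hom_group_eq_0_if_units)
  then show ?thesis by simp
qed

lemma hom_group_eqI: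
  assumes f: "f \<in> carrier hom_group" and g: "g \<in> carrier hom_group"
    and eq: "\<And>i. f (unit_seq i) = g (unit_seq i)"
  shows "f = g"
proof
  fix x
  have "1 * f x + (- 1) * g x = 0"
    using hom_group_combination[OF f g, of 1 "- 1"]
    by (rule hom_group_eq_0_if_units) (simp add: eq)
  then show "f x = g x" by simp
qed

section \<open>The algebraic structure of \<open>hom_group\<close>\<close>

lemma subgroup_hom_group: "subgroup (carrier hom_group) power_group"
  by (rule group.subgroupI[OF group_power_group])
    (auto simp: mem_hom_group_iff algebra_simps intro: exI[of _ "\<lambda>x. 0"])

text \<open>A functional corresponds to its values on the unit sequences. These determine it, only
  finitely many are nonzero, and every finitely supported choice comes from a linear combination of
  coordinates.\<close>

lemma hom_group_iso_free: "hom_group \<cong> free_Abelian_group (UNIV :: nat set)"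
proof -
  define F :: "((nat \<Rightarrow> int) \<Rightarrow> int) \<Rightarrow> (nat \<Rightarrow>\<^sub>0 int)"
    where "F f = Abs_poly_mapping (\<lambda>i. f (unit_seq i))" for f
  \<comment> \<open>\<open>Abs_poly_mapping\<close> is meaningful only at finitely supported
    functions, so Specker's finiteness enters here.\<close>
  have lookup: "Poly_Mapping.lookup (F f) i = f (unit_seq i)" if f: "f \<in> carrier hom_group" for f i
  proof -
    obtain n where "\<And>i. i \<ge> n \<Longrightarrow> f (unit_seq i) = 0"
      using hom_group_finite_support[OF f] by blast
    then have "{i. f (unit_seq i) \<noteq> 0} \<subseteq> {..<n}"
      by (auto simp: not_less[symmetric])
    then have "finite {i. f (unit_seq i) \<noteq> 0}"
      by (rule finite_subset) simp
    then show ?thesis by (simp add: F_def Abs_poly_mapping_inverse)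
  qed
  have "F \<in> iso hom_group (free_Abelian_group UNIV)"
  proof (rule isoI)
    show "F \<in> hom hom_group (free_Abelian_group UNIV)"
    proof (rule homI)
      fix f g
      assume fg: "f \<in> carrier hom_group" "g \<in> carrier hom_group"
      then have "f \<otimes>\<^bsub>hom_group\<^esub> g \<in> carrier hom_group"
        using hom_group_combination[OF fg, of 1 1] by simp
      then show "F (f \<otimes>\<^bsub>hom_group\<^esub> g) = F f \<otimes>\<^bsub>free_Abelian_group UNIV\<^esub> F g"
        using fg lookup by (intro poly_mapping_eqI) (simp add: free_Abelian_group_def lookup_add)
    qed (simp add: free_Abelian_group_def)
    show "bij_betw F (carrier hom_group) (carrier (free_Abelian_group UNIV))"
      unfolding bij_betw_def
    proof
      show "inj_on F (carrier hom_group)"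
      proof (rule inj_onI)
        fix f g
        assume "f \<in> carrier hom_group" "g \<in> carrier hom_group" "F f = F g"
        then show "f = g"
          by (intro hom_group_eqI) (simp_all flip: lookup)
      qed
      have "c \<in> F ` carrier hom_group" for c :: "nat \<Rightarrow>\<^sub>0 int"
      proof (rule image_eqI)
        let ?f = "\<lambda>x. \<Sum>i\<in>Poly_Mapping.keys c. Poly_Mapping.lookup c i * x i"
        show f: "?f \<in> carrier hom_group"
          by (rule hom_group_lincomb)
        have "?f (unit_seq j) = Poly_Mapping.lookup c j" for j
          by (simp add: of_bool_def if_distrib in_keys_iff cong: if_cong)
        then show "c = F ?f"
          using lookup[OF f] by (intro poly_mapping_eqI) simp
      qed
      then show "F ` carrier hom_group = carrier (free_Abelian_group UNIV)"
        by (auto simp: free_Abelian_group_def)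
    qed
  qed
  then show ?thesis by (auto simp: is_iso_def)
qed

section \<open>The circle\<close>

abbreviation circle_of :: "real \<Rightarrow> real set" where
  "circle_of r \<equiv> \<int> #>\<^bsub>real_group\<^esub> r"

lemma circle_of_eq_iff: "circle_of r = circle_of s \<longleftrightarrow> r - s \<in> \<int>"
proof
  assume "circle_of r = circle_of s"
  moreover have "r \<in> circle_of r"
    by (auto simp: r_coset_def real_group_def intro!: bexI[of _ 0])
  ultimately show "r - s \<in> \<int>"
    by (auto simp: r_coset_def real_group_def)
next
  assume rs: "r - s \<in> \<int>"
  have "\<exists>h'\<in>\<int>. h + r = h' + s" if "h \<in> \<int>" for h
    using rs that by (intro bexI[of _ "h + (r - s)"]) auto
  moreover have "\<exists>h'\<in>\<int>. h + s = h' + r" if "h \<in> \<int>" for h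
    using rs that by (intro bexI[of _ "h - (r - s)"]) auto
  ultimately show "circle_of r = circle_of s"
    by (auto simp: r_coset_def real_group_def)
qed

lemma carrier_circle_group: "carrier circle_group = range circle_of"
  by (simp add: circle_group_def carrier_FactGroup) (simp add: real_group_def)

lemma circle_of_in_carrier [simp]: "circle_of r \<in> carrier circle_group"
  by (simp add: carrier_circle_group)

lemma mult_circle_group [simp]:
  "circle_of r \<otimes>\<^bsub>circle_group\<^esub> circle_of s = circle_of (r + s)"
proof -
  have "\<exists>h\<in>\<int>. \<exists>k\<in>\<int>. l + (r + s) = h + r + (k + s)" if "l \<in> \<int>" for l :: real
    using that by (intro bexI[of _ l] bexI[of _ 0]) auto
  moreover have "\<exists>l\<in>\<int>. h + r + (k + s) = l + (r + s)" if "h \<in> \<int>" "k \<in> \<int>" for h k :: real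
    using that by (intro bexI[of _ "h + k"]) auto
  ultimately show ?thesis
    by (auto simp: circle_group_def r_coset_def set_mult_def real_group_def)
qed

text \<open>Identities are recognised as idempotents, and the circle has only one. The lemma thus
  applies to dual groups directly from their multiplication.\<close>

lemma circle_hom_one:
  assumes h: "h \<in> hom G circle_group" and x: "x \<in> carrier G" and xx: "x \<otimes>\<^bsub>G\<^esub> x = x"
  shows "h x = circle_of 0"
proof -
  obtain r where r: "h x = circle_of r"
    using hom_in_carrier[OF h x] by (auto simp: carrier_circle_group)
  have "circle_of (r + r) = circle_of r"
    using hom_mult[OF h x x] xx r by simp
  then show ?thesis by (simp add: r circle_of_eq_iff)
qed

lemma topspace_circle_topology [simp]: "topspace circle_topology = range circle_of"
proof -
  have "openin circle_topology (range circle_of)"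
    by (simp add: circle_topology_def openin_quotient_topology)
  moreover have "openin circle_topology U \<Longrightarrow> U \<subseteq> range circle_of" for U
    by (simp add: circle_topology_def openin_quotient_topology)
  ultimately show ?thesis
    by (meson openin_subset openin_topspace subset_antisym)
qed

lemma openin_circle_iff:
  "openin circle_topology U \<longleftrightarrow> U \<subseteq> range circle_of \<and> open {r. circle_of r \<in> U}"
  by (simp add: circle_topology_def openin_quotient_topology)

lemma open_plus_Ints: "open A \<Longrightarrow> open {r :: real. \<exists>k\<in>\<int>. r - k \<in> A}"
proof -
  assume "open A"
  have "{r :: real. \<exists>k\<in>\<int>. r - k \<in> A} = (\<Union>k\<in>\<int>. (\<lambda>r. r - k) -` A)" by auto
  moreover have "open ((\<lambda>r. r - k) -` A)" for k :: real
    by (intro open_vimage \<open>open A\<close> continuous_intros)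
  ultimately show ?thesis by auto
qed

lemma circle_of_image_iff: "circle_of r \<in> circle_of ` A \<longleftrightarrow> (\<exists>k\<in>\<int>. r - k \<in> A)"
proof
  assume "circle_of r \<in> circle_of ` A"
  then obtain a where "a \<in> A" "r - a \<in> \<int>" by (auto simp: circle_of_eq_iff)
  then show "\<exists>k\<in>\<int>. r - k \<in> A" by (intro bexI[of _ "r - a"]) auto
next
  assume "\<exists>k\<in>\<int>. r - k \<in> A"
  then obtain k where k: "k \<in> \<int>" "r - k \<in> A" by blast
  then have "circle_of r = circle_of (r - k)" by (simp add: circle_of_eq_iff)
  with k show "circle_of r \<in> circle_of ` A" by blast
qed

text \<open>The quotient map is open: the saturation of \<open>A\<close> is the union of its integer
  translates.\<close>

lemma openin_circle_image: "open A \<Longrightarrow> openin circle_topology (circle_of ` A)"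
  using open_plus_Ints[of A] by (auto simp: openin_circle_iff circle_of_image_iff)

lemma openin_circle_minus_one: "openin circle_topology (range circle_of - {circle_of 0})"
proof -
  have "{r. circle_of r \<in> range circle_of - {circle_of 0}} = - \<int>"
    by (auto simp: circle_of_eq_iff)
  then show ?thesis by (simp add: openin_circle_iff open_Compl closed_Ints)
qed

text \<open>With radius 1/4, a multiple that has just left the arc is still within 1/2 of 0 and
  cannot have wrapped round into it.\<close>

definition small_arc :: "real set set" where
  "small_arc = circle_of ` {-1/4<..<1/4}"

lemma openin_small_arc: "openin circle_topology small_arc"
  by (simp add: small_arc_def openin_circle_image)

text \<open>A nonzero representative \<open>s\<close> inside the arc has a first multiple outside
  it, which contradicts the hypothesis.\<close>

lemma no_small_subgroups:
  assumes r: "\<And>k::nat. circle_of (real k * r) \<in> small_arc"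
  shows "circle_of r = circle_of 0"
proof -
  obtain s where "s \<in> {-1/4<..<1/4}" and rs: "circle_of r = circle_of s"
    using r[of 1] unfolding small_arc_def by auto
  then have s: "\<bar>s\<bar> < 1/4" "circle_of r = circle_of s"
    by auto
  have rs: "r - s \<in> \<int>" using s by (simp add: circle_of_eq_iff)
  have "s = 0"
  proof (rule ccontr)
    assume "s \<noteq> 0"
    \<comment> \<open>The least \<open>k\<close> with
      \<open>real k * \<bar>s\<bar> \<ge> 1/4\<close>; the previous multiple was below 1/4, so this
      one is below 1/2.\<close>
    define k where "k = nat \<lceil>1 / (4 * \<bar>s\<bar>)\<rceil>"
    have "real k \<ge> 1 / (4 * \<bar>s\<bar>)" "real k < 1 / (4 * \<bar>s\<bar>) + 1"
      unfolding k_def by (auto simp: ceiling_correct) linarith+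
    with \<open>s \<noteq> 0\<close> have "real k * \<bar>s\<bar> \<ge> 1/4" "real k * \<bar>s\<bar> < 1/4 + \<bar>s\<bar>"
      by (auto simp: field_simps)
    with s have ks: "\<bar>real k * s\<bar> \<ge> 1/4" "\<bar>real k * s\<bar> < 1/2"
      by (auto simp: abs_mult)
    have "real k * (r - s) \<in> \<int>"
      using rs by (intro Ints_mult) auto
    then have "circle_of (real k * r) = circle_of (real k * s)"
      by (simp add: circle_of_eq_iff algebra_simps)
    with r[of k] obtain t where "t \<in> {-1/4<..<1/4}" "circle_of (real k * s) = circle_of t"
      unfolding small_arc_def by auto
    then have t: "\<bar>t\<bar> < 1/4" "real k * s - t \<in> \<int>"
      by (auto simp: circle_of_eq_iff)
    then obtain m where m: "real k * s - t = real_of_int m"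
      by (auto elim: Ints_cases)
    with ks t have "\<bar>real_of_int m\<bar> < 1" by linarith
    then have "m = 0" by simp
    with m ks t show False by simp
  qed
  with s show ?thesis by simp
qed

section \<open>The topology of pointwise convergence\<close>

lemma power_topology_eq: "power_topology = product_topology (\<lambda>_. discrete_topology UNIV) UNIV"
  by (simp add: power_topology_def)

lemma topspace_hom_topology [simp]: "topspace hom_topology = carrier hom_group"
  by (simp add: hom_topology_def power_topology_eq carrier_hom_group)

lemma continuous_map_power_eval:
  "continuous_map power_topology (discrete_topology UNIV) (\<lambda>f. f x)"
  unfolding power_topology_eq
  by (rule continuous_map_product_projection[where X = "\<lambda>_. discrete_topology UNIV"]) simp

lemma continuous_map_hom_eval:
  "continuous_map hom_topology (discrete_topology UNIV) (\<lambda>f. f x)"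
  unfolding hom_topology_def
  by (rule continuous_map_from_subtopology) (rule continuous_map_power_eval)

text \<open>A product of two discrete spaces is discrete, so every binary operation \<open>h\<close>
  is continuous on it.\<close>

lemma continuous_map_discrete_combine:
  assumes "continuous_map T (discrete_topology UNIV) a" "continuous_map T (discrete_topology UNIV) b"
  shows "continuous_map T (discrete_topology UNIV) (\<lambda>t. h (a t) (b t))"
proof -
  have "continuous_map T (prod_topology (discrete_topology UNIV) (discrete_topology UNIV)) (\<lambda>t. (a t, b t))"
    using assms by (rule continuous_map_pairedI)
  then have "continuous_map T (discrete_topology UNIV) (\<lambda>t. (a t, b t))"
    by (simp flip: prod_topology_discrete_topology)
  from continuous_map_compose[OF this, of "discrete_topology UNIV" "\<lambda>(x, y). h x y"]
  show ?thesis by (simp add: o_def)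
qed

lemma continuous_map_into_hom_topology:
  assumes "\<And>t. t \<in> topspace T \<Longrightarrow> F t \<in> carrier hom_group"
    and "\<And>x. continuous_map T (discrete_topology UNIV) (\<lambda>t. F t x)"
  shows "continuous_map T hom_topology F"
  unfolding hom_topology_def
  by (rule continuous_map_into_subtopology)
    (use assms in \<open>auto simp: power_topology_eq continuous_map_componentwise_UNIV carrier_hom_group\<close>)

text \<open>Each instance of additivity constrains three coordinates of \<open>f\<close>, hence is a
  closed condition; \<open>hom_group\<close> is the intersection of all of them.\<close>

lemma closedin_hom_group: "closedin power_topology (carrier hom_group)"
proof -
  have closed: "closedin power_topology {f \<in> topspace power_topology. f (\<lambda>i. x i + y i) - (f x + f y) \<in> {0}}"
    for x y
  proof (rule closedin_continuous_map_preimage[where Y = "discrete_topology UNIV"])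
    note sum = continuous_map_discrete_combine[OF continuous_map_power_eval continuous_map_power_eval,
        where h = "(+)"]
    show "continuous_map power_topology (discrete_topology UNIV) (\<lambda>f. f (\<lambda>i. x i + y i) - (f x + f y))"
      by (rule continuous_map_discrete_combine[OF continuous_map_power_eval sum])
  qed simp
  have "carrier hom_group
      = (\<Inter>x. \<Inter>y. {f \<in> topspace power_topology. f (\<lambda>i. x i + y i) - (f x + f y) \<in> {0}})"
    by (auto simp: mem_hom_group_iff power_topology_eq)
  also have "closedin power_topology \<dots>"
    by (intro closedin_INT closed) auto
  finally show ?thesis .
qed

lemma comm_group_hom_group: "comm_group hom_group"
proof (rule group.group_comm_groupI)
  show "group hom_group"
    using subgroup.subgroup_is_group[OF subgroup_hom_group group_power_group]
    by (simp add: hom_group_def)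
qed (simp add: algebra_simps)

lemma inv_hom_group:
  assumes "f \<in> carrier hom_group"
  shows "inv\<^bsub>hom_group\<^esub> f = (\<lambda>x. - f x)"
  using comm_group_hom_group assms
  by (intro group.inv_equality) (auto simp: comm_group_def mem_hom_group_iff)

lemma abelian_topological_group_hom_group: "abelian_topological_group hom_group hom_topology"
  unfolding abelian_topological_group_def
proof (intro conjI)
  have "continuous_map (prod_topology hom_topology hom_topology) (discrete_topology UNIV) (\<lambda>t. fst t x)"
    "continuous_map (prod_topology hom_topology hom_topology) (discrete_topology UNIV) (\<lambda>t. snd t x)" for x
    using continuous_map_compose[OF continuous_map_fst continuous_map_hom_eval]
      continuous_map_compose[OF continuous_map_snd continuous_map_hom_eval]
    by (simp_all add: o_def)
  then show "continuous_map (prod_topology hom_topology hom_topology) hom_topology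
      (\<lambda>(x, y). x \<otimes>\<^bsub>hom_group\<^esub> y)"
    by (intro continuous_map_into_hom_topology)
      (auto simp: mem_hom_group_iff case_prod_unfold intro: continuous_map_discrete_combine)
  have "continuous_map hom_topology hom_topology (\<lambda>f x. - f x)"
    using continuous_map_discrete_combine[OF continuous_map_hom_eval continuous_map_hom_eval, of "\<lambda>a b. - a"]
    by (intro continuous_map_into_hom_topology) (auto simp: mem_hom_group_iff)
  then show "continuous_map hom_topology hom_topology (\<lambda>x. inv\<^bsub>hom_group\<^esub> x)"
    by (rule continuous_map_eq) (simp add: inv_hom_group)
qed (simp_all add: comm_group_hom_group)

section \<open>Compact sets and isolated points\<close>

lemma compactin_hom_topology_finite_eval:
  assumes "compactin hom_topology K"
  shows "finite ((\<lambda>f. f x) ` K)"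
  using image_compactin[OF assms continuous_map_hom_eval[of x]]
  by (simp add: compactin_discrete_topology)

text \<open>Otherwise there are functionals \<open>\<psi> n\<close> in \<open>K\<close> whose last
  nonzero coordinate \<open>n\<close> is arbitrarily large. At a sequence \<open>x\<close> growing
  fast relative to all their coefficients the last term dominates, so
  \<open>\<bar>\<psi> n x\<bar>\<close> exceeds \<open>n\<close>, although \<open>K\<close> takes
  only finitely many values at \<open>x\<close>.\<close>

lemma compactin_hom_topology_bounded_support:
  assumes K: "compactin hom_topology K"
  shows "\<exists>n. \<forall>f\<in>K. \<forall>i\<ge>n. f (unit_seq i) = 0"
proof -
  have KG: "K \<subseteq> carrier hom_group"
    using compactin_subset_topspace[OF K] by simp
  define P where "P n f \<longleftrightarrow> f \<in> K \<and> f (unit_seq n) \<noteq> 0 \<and> (\<forall>i>n. f (unit_seq i) = 0)" for n f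
  have last: "\<exists>n\<ge>i. P n f" if f: "f \<in> K" and i: "f (unit_seq i) \<noteq> 0" for f i
  proof -
    obtain m where m: "\<And>j. j \<ge> m \<Longrightarrow> f (unit_seq j) = 0"
      using hom_group_finite_support f KG by blast
    let ?S = "{j. f (unit_seq j) \<noteq> 0}"
    have "?S \<subseteq> {..<m}" using m by (auto simp: not_less[symmetric])
    then have fin: "finite ?S" by (rule finite_subset) simp
    have "Max ?S \<in> ?S" by (rule Max_in[OF fin]) (use i in auto)
    moreover have "j \<le> Max ?S" if "j \<in> ?S" for j using fin that by (rule Max_ge)
    ultimately have "P (Max ?S) f" "i \<le> Max ?S"
      using f i unfolding P_def by (auto simp: not_less[symmetric])
    then show ?thesis by blast
  qed
  define \<psi> where "\<psi> n = (SOME f. P n f)" for n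
  define a where "a n i = \<psi> n (unit_seq i)" for n i
  define x where "x = growing_seq a"
  obtain B where B: "\<And>f. f \<in> K \<Longrightarrow> \<bar>f x\<bar> \<le> B"
  proof
    fix f
    assume "f \<in> K"
    then show "\<bar>f x\<bar> \<le> Max (insert 0 (abs ` (\<lambda>f. f x) ` K))"
      by (intro Max_ge) (auto simp: compactin_hom_topology_finite_eval[OF K])
  qed
  \<comment> \<open>The bound \<open>B\<close> on the values at \<open>x\<close> also bounds the
    supports.\<close>
  have "f (unit_seq i) = 0" if f: "f \<in> K" and i: "i \<ge> nat B" for f i
  proof (rule ccontr)
    assume "f (unit_seq i) \<noteq> 0"
    then obtain n where n: "n \<ge> i" "P n f" using last f by blast
    from n(2) have P: "P n (\<psi> n)" unfolding \<psi>_def by (rule someI[of "P n"])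
    have \<psi>: "\<psi> n \<in> K" "\<psi> n \<in> carrier hom_group" using P KG by (auto simp: P_def)
    have "\<psi> n x = (\<Sum>i<Suc n. a n i * x i)"
      unfolding a_def using P by (intro hom_group_expansion \<psi>) (auto simp: P_def)
    then have "\<psi> n x = (\<Sum>i<n. a n i * x i) + a n n * x n" by simp
    moreover have "\<bar>\<Sum>i<n. a n i * x i\<bar> \<le> (\<Sum>i<n. \<bar>a n i\<bar> * x i)"
      using growing_seq_pos[of a]
      by (intro order_trans[OF sum_abs] sum_mono)
        (simp add: x_def abs_mult order_trans[OF zero_le_one])
    moreover have "\<bar>a n n * x n\<bar> \<ge> 1 * x n"
      unfolding abs_mult using P growing_seq_pos[of a n]
      by (intro mult_mono) (auto simp: P_def a_def x_def)
    moreover have "x n \<ge> int n + 1 + (\<Sum>i<n. \<bar>a n i\<bar> * x i)"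
      unfolding x_def by (rule growing_seq_ge)
    ultimately have "\<bar>\<psi> n x\<bar> \<ge> int n + 1" by linarith
    with B[OF \<psi>(1)] n i show False by linarith
  qed
  then show ?thesis by blast
qed

text \<open>Given a solution \<open>f\<close> for \<open>F\<close>, take a second one
  \<open>g\<close> starting beyond the support of \<open>f\<close>, which the arbitrary
  \<open>m\<close> permits. A combination of the two also vanishes at the new point
  \<open>y\<close>, and it is nonzero because their supports are disjoint.\<close>

lemma hom_group_annihilator_nontrivial:
  assumes "finite F"
  shows "\<exists>f\<in>carrier hom_group. f \<noteq> (\<lambda>x. 0) \<and> (\<forall>x\<in>F. f x = 0) \<and> (\<forall>i<m. f (unit_seq i) = 0)"
  using assms
proof (induction F arbitrary: m rule: finite_induct)
  case empty
  have "(\<lambda>x. x m) \<in> carrier hom_group" by (simp add: mem_hom_group_iff)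
  moreover have "(\<lambda>x. x m) \<noteq> (\<lambda>x :: nat \<Rightarrow> int. 0)"
    by (auto simp: fun_eq_iff intro!: exI[of _ "\<lambda>_. 1"])
  ultimately show ?case by (intro bexI[of _ "\<lambda>x. x m"]) auto
next
  case (insert y F)
  obtain f where f: "f \<in> carrier hom_group" "f \<noteq> (\<lambda>x. 0)" "\<forall>x\<in>F. f x = 0" "\<forall>i<m. f (unit_seq i) = 0"
    using insert.IH[of m] by blast
  obtain n where n: "\<And>i. i \<ge> n \<Longrightarrow> f (unit_seq i) = 0"
    using hom_group_finite_support[OF f(1)] by blast
  obtain g where g: "g \<in> carrier hom_group" "g \<noteq> (\<lambda>x. 0)" "\<forall>x\<in>F. g x = 0"
      "\<forall>i<max m n. g (unit_seq i) = 0"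
    using insert.IH[of "max m n"] by blast
  show ?case
  proof (cases "f y = 0")
    case True
    with f show ?thesis by (intro bexI[of _ f]) auto
  next
    case False
    let ?h = "\<lambda>x. g y * f x + (- f y) * g x"
    have h: "?h \<in> carrier hom_group" by (rule hom_group_combination[OF f(1) g(1)])
    obtain i where i: "g (unit_seq i) \<noteq> 0"
      using hom_group_eq_0_if_units[OF g(1)] g(2) by blast
    then have "i \<ge> n" using g(4) by (meson leI less_max_iff_disj)
    \<comment> \<open>Here \<open>f\<close> contributes nothing, leaving
      \<open>- f y * g (unit_seq i)\<close>.\<close>
    then have "?h (unit_seq i) \<noteq> 0" using n i False by simp
    then have "?h \<noteq> (\<lambda>x. 0)" by meson
    moreover have "\<forall>x\<in>insert y F. ?h x = 0" "\<forall>i<m. ?h (unit_seq i) = 0"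
      using f g by auto
    ultimately show ?thesis using h by blast
  qed
qed

text \<open>A basic neighbourhood of \<open>f\<close> restricts finitely many coordinates; adding a
  nonzero functional that vanishes at them gives another element of it.\<close>

lemma hom_topology_no_isolated_points: "\<not> openin hom_topology {f}"
proof
  assume "openin hom_topology {f}"
  then obtain U where U: "openin power_topology U" "{f} = U \<inter> carrier hom_group"
    by (auto simp: hom_topology_def openin_subtopology carrier_hom_group)
  then have f: "f \<in> U" "f \<in> carrier hom_group" by auto
  obtain X where X: "f \<in> (\<Pi>\<^sub>E x\<in>UNIV. X x)" "finite {x. X x \<noteq> UNIV}" "(\<Pi>\<^sub>E x\<in>UNIV. X x) \<subseteq> U"
    using product_topology_open_contains_basis[OF U(1)[unfolded power_topology_eq] f(1)] by auto
  obtain g where g: "g \<in> carrier hom_group" "g \<noteq> (\<lambda>x. 0)" "\<And>x. X x \<noteq> UNIV \<Longrightarrow> g x = 0"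
    using hom_group_annihilator_nontrivial[OF X(2), of 0] by auto
  let ?h = "\<lambda>x. 1 * f x + 1 * g x"
  have "?h x \<in> X x" for x
    using X(1) g(3)[of x] by (cases "X x = UNIV") (auto simp: PiE_iff)
  then have "?h \<in> U" using X(3) by (auto simp: PiE_iff)
  moreover have "?h \<in> carrier hom_group" by (rule hom_group_combination[OF f(2) g(1)])
  ultimately have "?h = f" using U(2) by blast
  then have "g x = 0" for x using fun_cong[of ?h f x] by simp
  with g(2) show False by blast
qed

section \<open>Characters\<close>

text \<open>Continuity is checked on real representatives \<open>a\<close> and \<open>b\<close>: the
  arcs of radius \<open>e/2\<close> about them are open and their sums stay within \<open>e\<close>
  of \<open>a + b\<close>.\<close>

lemma continuous_map_circle_mult:
  assumes f: "continuous_map T circle_topology f" and g: "continuous_map T circle_topology g"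
  shows "continuous_map T circle_topology (\<lambda>t. f t \<otimes>\<^bsub>circle_group\<^esub> g t)"
  unfolding continuous_map_def
proof (intro conjI allI impI)
  have ex: "\<exists>r. f t = circle_of r" "\<exists>r. g t = circle_of r" if "t \<in> topspace T" for t
    using continuous_map_funspace[OF f] continuous_map_funspace[OF g] that
    by (simp_all add: Pi_iff image_iff)
  show "(\<lambda>t. f t \<otimes>\<^bsub>circle_group\<^esub> g t) \<in> topspace T \<rightarrow> topspace circle_topology"
    using ex by fastforce
  fix U
  assume U: "openin circle_topology U"
  show "openin T {t \<in> topspace T. f t \<otimes>\<^bsub>circle_group\<^esub> g t \<in> U}"
  proof (subst openin_subopen, intro ballI)
    fix t
    assume "t \<in> {t \<in> topspace T. f t \<otimes>\<^bsub>circle_group\<^esub> g t \<in> U}"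
    then have t: "t \<in> topspace T" "f t \<otimes>\<^bsub>circle_group\<^esub> g t \<in> U" by auto
    obtain a b where ab: "f t = circle_of a" "g t = circle_of b" using ex t by blast
    have "open {r. circle_of r \<in> U}" "a + b \<in> {r. circle_of r \<in> U}"
      using U t ab by (auto simp: openin_circle_iff)
    then obtain e where e: "e > 0" "ball (a + b) e \<subseteq> {r. circle_of r \<in> U}"
      by (meson openE)
    define V where "V = {t \<in> topspace T. f t \<in> circle_of ` ball a (e/2)}
      \<inter> {t \<in> topspace T. g t \<in> circle_of ` ball b (e/2)}"
    have "openin T V"
      unfolding V_def
      by (intro openin_Int openin_continuous_map_preimage[OF f] openin_continuous_map_preimage[OF g]
          openin_circle_image) auto
    moreover have "t \<in> V" using t ab e by (auto simp: V_def)
    moreover have "f u \<otimes>\<^bsub>circle_group\<^esub> g u \<in> U" if u: "u \<in> V" for u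
    proof -
      obtain c d where cd: "f u = circle_of c" "g u = circle_of d" "c \<in> ball a (e/2)" "d \<in> ball b (e/2)"
        using u unfolding V_def by (elim IntE CollectE conjE imageE) (rule that)
      have "dist (a + b) (c + d) \<le> dist a c + dist b d" by (rule dist_triangle_add)
      with cd have "c + d \<in> ball (a + b) e" by auto
      with e(2) cd show ?thesis by auto
    qed
    moreover have "V \<subseteq> topspace T" by (auto simp: V_def)
    ultimately show "\<exists>V. openin T V \<and> t \<in> V \<and> V \<subseteq> {t \<in> topspace T. f t \<otimes>\<^bsub>circle_group\<^esub> g t \<in> U}"
      by (intro exI[of _ V]) auto
  qed
qed

lemma circle_group_interchange:
  assumes "u \<in> carrier circle_group" "v \<in> carrier circle_group"
    "w \<in> carrier circle_group" "z \<in> carrier circle_group"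
  shows "(u \<otimes>\<^bsub>circle_group\<^esub> v) \<otimes>\<^bsub>circle_group\<^esub> (w \<otimes>\<^bsub>circle_group\<^esub> z)
    = (u \<otimes>\<^bsub>circle_group\<^esub> w) \<otimes>\<^bsub>circle_group\<^esub> (v \<otimes>\<^bsub>circle_group\<^esub> z)"
  using assms by (auto simp: carrier_circle_group algebra_simps)

section \<open>Dual groups and the compact-open topology\<close>

lemma carrier_dual_group:
  "\<xi> \<in> carrier (dual_group G T) \<longleftrightarrow>
     \<xi> \<in> hom G circle_group \<and> continuous_map T circle_topology \<xi> \<and> \<xi> \<in> extensional (carrier G)"
  by (auto simp: dual_group_def)

lemma mult_dual_group:
  "\<xi> \<otimes>\<^bsub>dual_group G T\<^esub> \<xi>' = (\<lambda>x\<in>carrier G. \<xi> x \<otimes>\<^bsub>circle_group\<^esub> \<xi>' x)"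
  by (simp add: dual_group_def)

lemma dual_group_mult_closed:
  assumes G: "group G" and \<xi>: "\<xi> \<in> carrier (dual_group G T)" and \<zeta>: "\<zeta> \<in> carrier (dual_group G T)"
    and T: "topspace T = carrier G"
  shows "\<xi> \<otimes>\<^bsub>dual_group G T\<^esub> \<zeta> \<in> carrier (dual_group G T)"
proof -
  have h: "\<xi> \<in> hom G circle_group" "\<zeta> \<in> hom G circle_group"
    and c: "continuous_map T circle_topology \<xi>" "continuous_map T circle_topology \<zeta>"
    using \<xi> \<zeta> by (auto simp: carrier_dual_group)
  have "\<xi> x \<otimes>\<^bsub>circle_group\<^esub> \<zeta> x \<in> carrier circle_group" if "x \<in> carrier G" for x
    using hom_in_carrier[OF h(1) that] hom_in_carrier[OF h(2) that]
    by (auto simp: carrier_circle_group)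
  then have "\<xi> \<otimes>\<^bsub>dual_group G T\<^esub> \<zeta> \<in> hom G circle_group"
    using h hom_in_carrier[OF h(1)] hom_in_carrier[OF h(2)] group.is_monoid[OF G]
    by (intro homI) (simp_all add: mult_dual_group hom_mult monoid.m_closed circle_group_interchange)
  moreover have "continuous_map T circle_topology (\<xi> \<otimes>\<^bsub>dual_group G T\<^esub> \<zeta>)"
    using continuous_map_circle_mult[OF c] by (rule continuous_map_eq) (simp add: mult_dual_group T)
  ultimately show ?thesis
    by (simp add: carrier_dual_group mult_dual_group)
qed

lemma topspace_dual_topology [simp]: "topspace (dual_topology G T) = carrier (dual_group G T)"
proof -
  have "{f \<in> carrier (dual_group G T). f ` {} \<subseteq> {}} \<in>
      {{f \<in> carrier (dual_group G T). f ` K \<subseteq> U} | K U. compactin T K \<and> openin circle_topology U}"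
    by (intro CollectI exI[of _ "{}"]) auto
  then show ?thesis
    by (auto simp: dual_topology_def)
qed

abbreviation first_dual :: "(((nat \<Rightarrow> int) \<Rightarrow> int) \<Rightarrow> real set) monoid" where
  "first_dual \<equiv> dual_group hom_group hom_topology"

abbreviation first_dual_topology :: "(((nat \<Rightarrow> int) \<Rightarrow> int) \<Rightarrow> real set) topology" where
  "first_dual_topology \<equiv> dual_topology hom_group hom_topology"

text \<open>Agreement on the subgroup generated by the first \<open>n\<close> coordinate
  functionals.\<close>

definition agree_below ::
  "nat \<Rightarrow> (((nat \<Rightarrow> int) \<Rightarrow> int) \<Rightarrow> real set) \<Rightarrow> (((nat \<Rightarrow> int) \<Rightarrow> int) \<Rightarrow> real set) \<Rightarrow> bool" where
  "agree_below n \<xi> \<zeta> \<longleftrightarrow>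
     (\<forall>\<phi>\<in>carrier hom_group. (\<forall>i\<ge>n. \<phi> (unit_seq i) = 0) \<longrightarrow> \<xi> \<phi> = \<zeta> \<phi>)"

lemma agree_below_mono: "agree_below n \<xi> \<zeta> \<Longrightarrow> m \<le> n \<Longrightarrow> agree_below m \<xi> \<zeta>"
  unfolding agree_below_def by (meson order_trans)

text \<open>A compact set involves only finitely many coordinates, so a subbasic condition sees a
  character only there. Finite intersections are handled by the larger of the two bounds.\<close>

lemma first_dual_topology_neighbourhood:
  assumes "openin first_dual_topology W" "\<xi> \<in> W"
  shows "\<exists>n. \<forall>\<zeta> \<in> carrier first_dual. agree_below n \<xi> \<zeta> \<longrightarrow> \<zeta> \<in> W"
  using assms(1)[unfolded dual_topology_def openin_topology_generated_by_iff] assms(2)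
proof (induction rule: generate_topology_on.induct)
  case Empty
  then show ?case by simp
next
  case (Int a b)
  then have "\<xi> \<in> a" "\<xi> \<in> b" by auto
  from Int.IH(1)[OF this(1)] Int.IH(2)[OF this(2)] obtain m n where
    "\<forall>\<zeta> \<in> carrier first_dual. agree_below m \<xi> \<zeta> \<longrightarrow> \<zeta> \<in> a"
    "\<forall>\<zeta> \<in> carrier first_dual. agree_below n \<xi> \<zeta> \<longrightarrow> \<zeta> \<in> b"
    by blast
  then show ?case
    using agree_below_mono[of "max m n" \<xi>] by (intro exI[of _ "max m n"]) auto
next
  case (UN \<K>)
  then obtain k where k: "k \<in> \<K>" "\<xi> \<in> k" by blast
  with UN.IH show ?case by blast
next
  case (Basis s)
  from Basis.hyps obtain K U where s: "s = {f \<in> carrier first_dual. f ` K \<subseteq> U}"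
    and K: "compactin hom_topology K"
    by blast
  obtain n where n: "\<forall>f\<in>K. \<forall>i\<ge>n. f (unit_seq i) = 0"
    using compactin_hom_topology_bounded_support[OF K] by blast
  have KG: "K \<subseteq> carrier hom_group"
    using compactin_subset_topspace[OF K] by simp
  have "\<zeta> \<in> s" if \<zeta>: "\<zeta> \<in> carrier first_dual" "agree_below n \<xi> \<zeta>" for \<zeta>
  proof -
    have "\<zeta> \<phi> \<in> U" if "\<phi> \<in> K" for \<phi>
    proof -
      have "\<xi> \<phi> = \<zeta> \<phi>"
        using \<zeta>(2) n that KG unfolding agree_below_def by auto
      moreover have "\<xi> \<phi> \<in> U"
        using Basis.prems that s by auto
      ultimately show ?thesis by simp
    qed
    with \<zeta> show ?thesis by (auto simp: s)
  qed
  then show ?case by blast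
qed

section \<open>Coordinate characters\<close>

text \<open>The point \<open>r\<close> of the \<open>n\<close>-th circle in the dual: the
  \<open>n\<close>-th coordinate functional goes to the class of \<open>r\<close>, all others to
  0.\<close>

definition coord_char :: "nat \<Rightarrow> real \<Rightarrow> ((nat \<Rightarrow> int) \<Rightarrow> int) \<Rightarrow> real set" where
  "coord_char n r = (\<lambda>\<phi>\<in>carrier hom_group. circle_of (r * of_int (\<phi> (unit_seq n))))"

lemma coord_char_in_dual: "coord_char n r \<in> carrier first_dual"
  unfolding carrier_dual_group
proof (intro conjI)
  show "coord_char n r \<in> hom hom_group circle_group"
  proof (rule homI)
    fix \<phi> \<psi>
    assume \<phi>\<psi>: "\<phi> \<in> carrier hom_group" "\<psi> \<in> carrier hom_group"
    then have "\<phi> \<otimes>\<^bsub>hom_group\<^esub> \<psi> \<in> carrier hom_group"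
      by (auto simp: mem_hom_group_iff)
    with \<phi>\<psi> show "coord_char n r (\<phi> \<otimes>\<^bsub>hom_group\<^esub> \<psi>)
        = coord_char n r \<phi> \<otimes>\<^bsub>circle_group\<^esub> coord_char n r \<psi>"
      by (simp add: coord_char_def distrib_left)
  qed (simp add: coord_char_def)
  \<comment> \<open>The character factors through evaluation into the discrete integers.\<close>
  have "continuous_map hom_topology circle_topology
      ((\<lambda>k. circle_of (r * of_int k)) \<circ> (\<lambda>\<phi>. \<phi> (unit_seq n)))"
    by (rule continuous_map_compose[OF continuous_map_hom_eval]) simp
  then show "continuous_map hom_topology circle_topology (coord_char n r)"
    by (rule continuous_map_eq) (simp add: coord_char_def)
qed (simp add: coord_char_def)

lemma coord_char_add:
  "coord_char n r \<otimes>\<^bsub>first_dual\<^esub> coord_char n s = coord_char n (r + s)"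
  by (auto simp: mult_dual_group coord_char_def fun_eq_iff distrib_right)

text \<open>Parameters in \<open>{0..1}\<close> therefore already give the whole circle.\<close>

lemma coord_char_frac: "coord_char n (frac r) = coord_char n r"
proof -
  have "circle_of (frac r * of_int k) = circle_of (r * of_int k)" for k
    by (simp add: circle_of_eq_iff frac_def algebra_simps)
  then show ?thesis by (simp add: coord_char_def fun_eq_iff)
qed

text \<open>On a compact \<open>K\<close> the \<open>n\<close>-th coordinate takes finitely many
  values, so a subbasic set imposes finitely many open conditions on \<open>r\<close>.\<close>

lemma continuous_map_coord_char:
  "continuous_map euclideanreal first_dual_topology (coord_char n)"
  unfolding dual_topology_def
proof (rule continuous_on_generated_topo)
  fix W
  assume "W \<in> {{f \<in> carrier first_dual. f ` K \<subseteq> U} | K U.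
    compactin hom_topology K \<and> openin circle_topology U}"
  then obtain K U where W: "W = {f \<in> carrier first_dual. f ` K \<subseteq> U}"
    and K: "compactin hom_topology K" and U: "openin circle_topology U"
    by blast
  have KG: "K \<subseteq> carrier hom_group"
    using compactin_subset_topspace[OF K] by simp
  define A where "A = (\<lambda>\<phi>. \<phi> (unit_seq n)) ` K"
  have "finite A"
    unfolding A_def by (rule compactin_hom_topology_finite_eval[OF K])
  have "open ((\<lambda>r. r * of_int k) -` {r. circle_of r \<in> U})" for k
    using U by (intro open_vimage continuous_intros) (simp add: openin_circle_iff)
  then have "open (\<Inter>k\<in>A. (\<lambda>r. r * of_int k) -` {r. circle_of r \<in> U})"
    using \<open>finite A\<close> by (intro open_INT) auto
  also have "(\<Inter>k\<in>A. (\<lambda>r. r * of_int k) -` {r. circle_of r \<in> U}) = coord_char n -` W"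
    using KG by (auto simp: W A_def coord_char_in_dual) (auto simp: coord_char_def subset_iff)
  finally show "openin euclideanreal (coord_char n -` W \<inter> topspace euclideanreal)"
    by simp
next
  show "coord_char n ` topspace euclideanreal \<subseteq>
    \<Union>{{f \<in> carrier first_dual. f ` K \<subseteq> U} | K U. compactin hom_topology K \<and> openin circle_topology U}"
    using coord_char_in_dual topspace_dual_topology[of hom_group hom_topology]
    unfolding dual_topology_def topology_generated_by_topspace by auto
qed

text \<open>Every neighbourhood of the trivial character contains all but finitely many of the circles.\<close>

lemma compactin_coord_chars: "compactin first_dual_topology (\<Union>n. coord_char n ` {0..1})"
  unfolding compactin_def
proof (intro conjI allI impI)
  show "(\<Union>n. coord_char n ` {0..1}) \<subseteq> topspace first_dual_topology"
    using coord_char_in_dual by auto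
next
  fix \<U>
  assume \<U>: "(\<forall>U\<in>\<U>. openin first_dual_topology U) \<and> (\<Union>n. coord_char n ` {0..1}) \<subseteq> \<Union>\<U>"
  \<comment> \<open>\<open>coord_char 0 0\<close> is the trivial character, to which the circles
    converge.\<close>
  have "coord_char 0 0 \<in> (\<Union>n. coord_char n ` {0..1})"
    by (intro UN_I[of 0] imageI) auto
  with \<U> obtain W where W: "W \<in> \<U>" "coord_char 0 0 \<in> W" by blast
  have "openin first_dual_topology W" using \<U> W(1) by blast
  from first_dual_topology_neighbourhood[OF this W(2)] obtain n where
    n: "\<And>\<zeta>. \<zeta> \<in> carrier first_dual \<Longrightarrow> agree_below n (coord_char 0 0) \<zeta> \<Longrightarrow> \<zeta> \<in> W"
    by blast
  \<comment> \<open>On functionals supported below \<open>n\<close>, the character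
    \<open>coord_char m r\<close> is trivial.\<close>
  have tail: "coord_char m r \<in> W" if "m \<ge> n" for m r
    using that by (intro n coord_char_in_dual) (simp add: agree_below_def coord_char_def)
  \<comment> \<open>Only the circles below \<open>n\<close> remain, finitely many continuous images
    of an interval.\<close>
  have "compactin first_dual_topology (coord_char m ` {0..1})" for m
    by (rule image_compactin[OF _ continuous_map_coord_char]) simp
  then have "compactin first_dual_topology (\<Union>((\<lambda>m. coord_char m ` {0..1}) ` {..<n}))"
    by (intro compactin_Union) auto
  moreover have "\<Union>((\<lambda>m. coord_char m ` {0..1}) ` {..<n}) \<subseteq> \<Union>\<U>"
    using \<U> by blast
  moreover have "\<forall>U\<in>\<U>. openin first_dual_topology U"
    using \<U> by blast
  ultimately obtain \<F> where \<F>: "finite \<F>" "\<F> \<subseteq> \<U>" "\<Union>((\<lambda>m. coord_char m ` {0..1}) ` {..<n}) \<subseteq> \<Union>\<F>"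
    unfolding compactin_def by meson
  have "coord_char m r \<in> \<Union>(insert W \<F>)" if "r \<in> {0..1}" for m r
  proof (cases "m < n")
    case True
    with that have "coord_char m r \<in> \<Union>((\<lambda>m. coord_char m ` {0..1}) ` {..<n})" by blast
    with \<F>(3) show ?thesis by auto
  qed (use tail in auto)
  then have "(\<Union>n. coord_char n ` {0..1}) \<subseteq> \<Union>(insert W \<F>)" by blast
  with \<F> W show "\<exists>\<F>. finite \<F> \<and> \<F> \<subseteq> \<U> \<and> (\<Union>n. coord_char n ` {0..1}) \<subseteq> \<Union>\<F>"
    by (intro exI[of _ "insert W \<F>"]) auto
qed

section \<open>Truncations of functionals and characters\<close>

definition truncation :: "nat \<Rightarrow> ((nat \<Rightarrow> int) \<Rightarrow> int) \<Rightarrow> (nat \<Rightarrow> int) \<Rightarrow> int" where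
  "truncation n \<phi> = (\<lambda>x. \<Sum>i<n. \<phi> (unit_seq i) * x i)"

lemma truncation_in_hom_group [simp]: "truncation n \<phi> \<in> carrier hom_group"
  unfolding truncation_def by (rule hom_group_lincomb)

lemma continuous_map_truncation: "continuous_map hom_topology hom_topology (truncation n)"
proof (rule continuous_map_into_hom_topology)
  fix x
  show "continuous_map hom_topology (discrete_topology UNIV) (\<lambda>\<phi>. truncation n \<phi> x)"
  proof (induction n)
    case (Suc n)
    from continuous_map_discrete_combine[OF this continuous_map_hom_eval[of "unit_seq n"], of "\<lambda>a b. a + b * x n"]
    show ?case by (simp add: truncation_def)
  qed (simp add: truncation_def)
qed simp

definition truncated_char ::
  "nat \<Rightarrow> (((nat \<Rightarrow> int) \<Rightarrow> int) \<Rightarrow> real set) \<Rightarrow> ((nat \<Rightarrow> int) \<Rightarrow> int) \<Rightarrow> real set" where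
  "truncated_char n \<xi> = (\<lambda>\<phi>\<in>carrier hom_group. \<xi> (truncation n \<phi>))"

lemma truncated_char_in_dual:
  assumes \<xi>: "\<xi> \<in> carrier first_dual"
  shows "truncated_char n \<xi> \<in> carrier first_dual"
  unfolding carrier_dual_group
proof (intro conjI)
  have hom: "\<xi> \<in> hom hom_group circle_group" and cont: "continuous_map hom_topology circle_topology \<xi>"
    using \<xi> by (auto simp: carrier_dual_group)
  show "truncated_char n \<xi> \<in> hom hom_group circle_group"
  proof (rule homI)
    fix \<phi> \<psi>
    assume \<phi>\<psi>: "\<phi> \<in> carrier hom_group" "\<psi> \<in> carrier hom_group"
    then have "\<phi> \<otimes>\<^bsub>hom_group\<^esub> \<psi> \<in> carrier hom_group"
      by (auto simp: mem_hom_group_iff)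
    moreover have "truncation n (\<phi> \<otimes>\<^bsub>hom_group\<^esub> \<psi>) = truncation n \<phi> \<otimes>\<^bsub>hom_group\<^esub> truncation n \<psi>"
      by (simp add: truncation_def distrib_right sum.distrib)
    ultimately show "truncated_char n \<xi> (\<phi> \<otimes>\<^bsub>hom_group\<^esub> \<psi>)
        = truncated_char n \<xi> \<phi> \<otimes>\<^bsub>circle_group\<^esub> truncated_char n \<xi> \<psi>"
      using \<phi>\<psi> hom_mult[OF hom, of "truncation n \<phi>" "truncation n \<psi>"]
      by (simp add: truncated_char_def del: mult_hom_group)
  qed (use hom_in_carrier[OF hom] in \<open>simp add: truncated_char_def\<close>)
  show "continuous_map hom_topology circle_topology (truncated_char n \<xi>)"
    using continuous_map_compose[OF continuous_map_truncation cont]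
    by (rule continuous_map_eq) (simp add: truncated_char_def)
qed (simp add: truncated_char_def)

lemma circle_hom_multiple:
  assumes \<xi>: "\<xi> \<in> hom hom_group circle_group" and \<phi>: "\<phi> \<in> carrier hom_group" and r: "\<xi> \<phi> = circle_of r"
  shows "\<xi> (\<lambda>x. k * \<phi> x) = circle_of (r * of_int k)"
proof -
  have G: "(\<lambda>x. k * \<phi> x) \<in> carrier hom_group" for k
    using hom_group_combination[OF \<phi> \<phi>, of k 0] by simp
  have step: "\<xi> (\<lambda>x. (k + 1) * \<phi> x) = \<xi> (\<lambda>x. k * \<phi> x) \<otimes>\<^bsub>circle_group\<^esub> circle_of r" for k
    using hom_mult[OF \<xi> G[of k] \<phi>] by (simp add: r distrib_right)
  show ?thesis
  proof (induction k rule: int_induct[where k = 0])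
    case base
    have "\<xi> (\<lambda>x. 0) = circle_of 0"
      by (rule circle_hom_one[OF \<xi>]) (use G[of 0] in auto)
    then show ?case by simp
  next
    case (step1 k)
    then show ?case using step[of k] by (simp add: distrib_left add.commute)
  next
    case (step2 k)
    \<comment> \<open>Downwards, \<open>step\<close> yields the wanted value only after cancelling
      \<open>circle_of r\<close>, hence the real representative \<open>s\<close>.\<close>
    obtain s where s: "\<xi> (\<lambda>x. (k - 1) * \<phi> x) = circle_of s"
      using hom_in_carrier[OF \<xi> G[of "k - 1"]] by (auto simp: carrier_circle_group)
    have "circle_of (s + r) = circle_of (r * of_int k)"
      using step[of "k - 1"] step2 s by simp
    then show ?case unfolding s by (simp add: circle_of_eq_iff algebra_simps)
  qed
qed

text \<open>By induction every truncated character is a finite product of coordinate characters. The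
  witness \<open>r\<close> represents the value of \<open>\<xi>\<close> at the \<open>n\<close>-th
  coordinate functional.\<close>

lemma truncated_char_Suc:
  assumes \<xi>: "\<xi> \<in> carrier first_dual"
  shows "\<exists>r. truncated_char (Suc n) \<xi> = truncated_char n \<xi> \<otimes>\<^bsub>first_dual\<^esub> coord_char n r"
proof -
  have hom: "\<xi> \<in> hom hom_group circle_group"
    using \<xi> by (auto simp: carrier_dual_group)
  have e: "(\<lambda>x. x n) \<in> carrier hom_group" by (simp add: mem_hom_group_iff)
  obtain r where r: "\<xi> (\<lambda>x. x n) = circle_of r"
    using hom_in_carrier[OF hom e] by (auto simp: carrier_circle_group)
  have G: "(\<lambda>x. k * x n) \<in> carrier hom_group" for k
    by (simp add: mem_hom_group_iff distrib_left)
  have "\<xi> (truncation (Suc n) \<phi>) = \<xi> (truncation n \<phi>) \<otimes>\<^bsub>circle_group\<^esub> circle_of (r * of_int (\<phi> (unit_seq n)))" for \<phi>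
    using hom_mult[OF hom truncation_in_hom_group[of n \<phi>] G[of "\<phi> (unit_seq n)"]]
      circle_hom_multiple[OF hom e r, of "\<phi> (unit_seq n)"]
    by (simp add: truncation_def)
  then show ?thesis
    by (intro exI[of _ r]) (auto simp: mult_dual_group truncated_char_def coord_char_def fun_eq_iff)
qed

section \<open>The second dual is discrete\<close>

text \<open>Multiples of a point of the \<open>n\<close>-th circle stay on that circle, so all
  multiples of its image lie in the small arc and the image is trivial.\<close>

lemma second_dual_small_on_coord_chars:
  assumes \<eta>: "\<eta> \<in> carrier (dual_group first_dual first_dual_topology)"
    and small: "\<eta> ` (\<Union>n. coord_char n ` {0..1}) \<subseteq> small_arc"
  shows "\<eta> (coord_char n r) = circle_of 0"
proof -
  have hom: "\<eta> \<in> hom first_dual circle_group"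
    using \<eta> by (simp add: carrier_dual_group)
  obtain s where s: "\<eta> (coord_char n r) = circle_of s"
    using hom_in_carrier[OF hom coord_char_in_dual[of n r]] by (auto simp: carrier_circle_group)
  have mult: "\<eta> (coord_char n (real k * r)) = circle_of (real k * s)" for k
  proof (induction k)
    case 0
    show ?case
      using coord_char_add[of n 0 0]
      by (simp add: circle_hom_one[OF hom coord_char_in_dual])
  next
    case (Suc k)
    then show ?case
      using hom_mult[OF hom coord_char_in_dual[of n "real k * r"] coord_char_in_dual[of n r]] s
      by (simp add: coord_char_add algebra_simps)
  qed
  have "\<eta> (coord_char n t) \<in> small_arc" for t
  proof -
    have "coord_char n (frac t) \<in> (\<Union>n. coord_char n ` {0..1})"
      using frac_ge_0[of t] frac_lt_1[of t] by (intro UN_I[of n] imageI) auto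
    with small show ?thesis unfolding coord_char_frac by blast
  qed
  then have "circle_of (real k * s) \<in> small_arc" for k
    by (metis mult)
  then show ?thesis
    by (simp add: s no_small_subgroups)
qed

text \<open>Products of coordinate characters are dense: \<open>\<xi>\<close> is the limit of its truncations.\<close>

lemma second_dual_trivial_if_small:
  assumes \<eta>: "\<eta> \<in> carrier (dual_group first_dual first_dual_topology)"
    and small: "\<eta> ` (\<Union>n. coord_char n ` {0..1}) \<subseteq> small_arc"
    and \<xi>: "\<xi> \<in> carrier first_dual"
  shows "\<eta> \<xi> = circle_of 0"
proof (rule ccontr)
  assume neq: "\<eta> \<xi> \<noteq> circle_of 0"
  have hom: "\<eta> \<in> hom first_dual circle_group"
    and cont: "continuous_map first_dual_topology circle_topology \<eta>"
    using \<eta> by (auto simp: carrier_dual_group)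
  \<comment> \<open>The set where \<open>\<eta>\<close> is nontrivial is open, so if it contained
    \<open>\<xi>\<close> it would contain some truncation of \<open>\<xi>\<close>.\<close>
  define W where "W = {\<xi> \<in> topspace first_dual_topology. \<eta> \<xi> \<in> range circle_of - {circle_of 0}}"
  have "openin first_dual_topology W"
    unfolding W_def by (rule openin_continuous_map_preimage[OF cont openin_circle_minus_one])
  moreover have "\<xi> \<in> W"
    using \<xi> neq hom_in_carrier[OF hom \<xi>] by (simp add: W_def carrier_circle_group)
  ultimately obtain n where
    n: "\<And>\<zeta>. \<zeta> \<in> carrier first_dual \<Longrightarrow> agree_below n \<xi> \<zeta> \<Longrightarrow> \<zeta> \<in> W"
    using first_dual_topology_neighbourhood[of W \<xi>] by blast
  have "agree_below n \<xi> (truncated_char n \<xi>)"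
    unfolding agree_below_def
  proof (intro ballI impI)
    fix \<phi> :: "(nat \<Rightarrow> int) \<Rightarrow> int"
    assume \<phi>: "\<phi> \<in> carrier hom_group" and zero: "\<forall>i\<ge>n. \<phi> (unit_seq i) = 0"
    have "\<phi> x = truncation n \<phi> x" for x
      unfolding truncation_def by (rule hom_group_expansion[OF \<phi>]) (use zero in blast)
    then have "truncation n \<phi> = \<phi>"
      by (intro ext) (rule sym)
    with \<phi> show "\<xi> \<phi> = truncated_char n \<xi> \<phi>" by (simp add: truncated_char_def)
  qed
  then have "truncated_char n \<xi> \<in> W"
    by (rule n[OF truncated_char_in_dual[OF \<xi>]])
  moreover have "\<eta> (truncated_char m \<xi>) = circle_of 0" for m
  proof (induction m)
    case 0
    have "\<xi> \<in> hom hom_group circle_group"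
      using \<xi> by (simp add: carrier_dual_group)
    then have "\<xi> (\<lambda>x. 0) = circle_of 0"
      by (rule circle_hom_one) (simp_all add: mem_hom_group_iff)
    then have "truncated_char 0 \<xi> = coord_char 0 0"
      by (simp add: truncated_char_def truncation_def coord_char_def)
    then show ?case using second_dual_small_on_coord_chars[OF \<eta> small] by simp
  next
    case (Suc m)
    obtain r where "truncated_char (Suc m) \<xi> = truncated_char m \<xi> \<otimes>\<^bsub>first_dual\<^esub> coord_char m r"
      using truncated_char_Suc[OF \<xi>] by blast
    then show ?case
      using hom_mult[OF hom truncated_char_in_dual[OF \<xi>, of m] coord_char_in_dual[of m r]] Suc
        second_dual_small_on_coord_chars[OF \<eta> small, of m r] by simp
  qed
  ultimately show False by (simp add: W_def)
qed

text \<open>The compact union of circles and the small arc define a subbasic open set of the second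
  dual, which consists of the trivial character alone.\<close>

lemma second_dual_isolated_point:
  "\<exists>\<eta>. openin (dual_topology first_dual first_dual_topology) {\<eta>}"
proof -
  define V where "V = {\<eta> \<in> carrier (dual_group first_dual first_dual_topology).
    \<eta> ` (\<Union>n. coord_char n ` {0..1}) \<subseteq> small_arc}"
  define \<epsilon> :: "(((nat \<Rightarrow> int) \<Rightarrow> int) \<Rightarrow> real set) \<Rightarrow> real set"
    where "\<epsilon> = (\<lambda>\<xi>\<in>carrier first_dual. circle_of 0)"
  have "openin (dual_topology first_dual first_dual_topology) V"
    unfolding dual_topology_def[of first_dual] V_def
    by (rule topology_generated_by_Basis) (use compactin_coord_chars openin_small_arc in blast)
  moreover have "\<eta> = \<epsilon>" if "\<eta> \<in> V" for \<eta>
  proof (rule extensionalityI[where A = "carrier first_dual"])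
    show "\<eta> \<xi> = \<epsilon> \<xi>" if "\<xi> \<in> carrier first_dual" for \<xi>
      using second_dual_trivial_if_small[of \<eta> \<xi>] that \<open>\<eta> \<in> V\<close> by (simp add: V_def \<epsilon>_def)
  qed (use that in \<open>auto simp: V_def \<epsilon>_def carrier_dual_group\<close>)
  moreover have "\<epsilon> \<in> V"
  proof -
    have hom: "\<epsilon> \<in> hom first_dual circle_group"
    proof (rule homI)
      fix \<xi> \<xi>'
      assume \<xi>: "\<xi> \<in> carrier first_dual" "\<xi>' \<in> carrier first_dual"
      \<comment> \<open>Off the carrier \<open>\<epsilon>\<close> is \<open>undefined\<close>, so
        evaluating it at a product requires the product to be a character.\<close>
      moreover have "\<xi> \<otimes>\<^bsub>first_dual\<^esub> \<xi>' \<in> carrier first_dual"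
        using comm_group_hom_group
        by (intro dual_group_mult_closed \<xi>) (simp_all add: comm_group_def)
      ultimately show "\<epsilon> (\<xi> \<otimes>\<^bsub>first_dual\<^esub> \<xi>') = \<epsilon> \<xi> \<otimes>\<^bsub>circle_group\<^esub> \<epsilon> \<xi>'"
        by (simp add: \<epsilon>_def)
    qed (simp add: \<epsilon>_def)
    have cont: "continuous_map first_dual_topology circle_topology \<epsilon>"
      by (rule continuous_map_eq[where f = "\<lambda>_. circle_of 0"]) (auto simp: \<epsilon>_def)
    have "\<epsilon> \<in> extensional (carrier first_dual)"
      by (simp add: \<epsilon>_def)
    with hom cont have "\<epsilon> \<in> carrier (dual_group first_dual first_dual_topology)"
      unfolding carrier_dual_group[of \<epsilon>] by blast
    moreover have "\<epsilon> (coord_char n r) = circle_of 0" for n r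
      by (simp add: \<epsilon>_def coord_char_in_dual)
    moreover have "circle_of 0 \<in> small_arc" by (auto simp: small_arc_def)
    ultimately show ?thesis by (auto simp: V_def)
  qed
  ultimately have "V = {\<epsilon>}" by blast
  then show ?thesis using \<open>openin _ V\<close> by auto
qed

text \<open>Homeomorphisms preserve isolated points, so no topological isomorphism exists at all,
  canonical or not.\<close>

lemma not_reflexive_hom_group: "\<not> reflexive hom_group hom_topology"
proof
  assume "reflexive hom_group hom_topology"
  then obtain f where f: "homeomorphic_map (dual_topology first_dual first_dual_topology) hom_topology f"
    by (auto simp: reflexive_def topologically_isomorphic_def)
  obtain \<eta> where "openin (dual_topology first_dual first_dual_topology) {\<eta>}"
    using second_dual_isolated_point by blast
  then have "openin hom_topology (f ` {\<eta>})"
    using homeomorphic_map_openness_eq[OF f] by blast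
  then show False
    by (simp add: hom_topology_no_isolated_points)
qed

theorem corollary3p4:
  shows "subgroup (carrier hom_group) power_group \<and>
    closedin power_topology (carrier hom_group) \<and>
    hom_group \<cong> free_Abelian_group (UNIV :: nat set) \<and>
    non_reflexive hom_group hom_topology"
  using subgroup_hom_group closedin_hom_group hom_group_iso_free
    abelian_topological_group_hom_group not_reflexive_hom_group
  by (auto simp: non_reflexive_def)

end
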